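(* Let $B$ be a $d$-dimensional brick with $d\ge1$, let $Y\subseteq\mathbb{R}^\infty$ be a robust configuration, and let $F$ be a finite configuration. If $B\times Y$ contains a copy of $F$ and $Y$ does not contain a copy of $F$, then $F$ is P-Ramsey.
   Context: $\mathbb{R}^\infty$ denotes the subspace of $\ell^2$ of real sequences with only finitely many nonzero entries, with the Euclidean metric. A configuration is a set of points of $\mathbb{R}^\infty$. A copy of a configuration $B$ (a configuration congruent to $B$) is a configuration $B'$ for which there is a distance-preserving bijection $B\to B'$; a configuration $A$ contains a copy of $B$ if some subset of $A$ is a copy of $B$. A configuration is $X$-free if it contains no copy of $X$. For configurations $A,B$ and an integer $r\ge1$, $A\rightarrow(B)_r$ means that every coloring of the points of $A$ with $r$ colors admits a monochromatic subset of $A$ that is a copy of $B$. The product $A\times B$ of configurations is the Cartesian product with $\|(a,b)-(a',b')\|^2=\|a-a'\|^2+\|b-b'\|^2$, regarded as a configuration in $\mathbb{R}^\infty$ (up to isometry). A configuration $B$ is a $d$-dimensional brick if there exist positive real numbers $a_1,\ldots,a_d$ such that $B$ is congruent to $\{(x_1,\ldots,x_d): x_i=0\text{ or }x_i=a_i,\ 1\le i\le d\}$. A countable configuration $Y$ is robust if for every finite configuration $C$ such that $Y$ contains a copy of $C$, we have $Y\rightarrow(C)_r$ for every integer $r\ge1$. A finite configuration $X\subseteq\mathbb{R}^\infty$ is P-Ramsey if there exist a configuration $W\subseteq\mathbb{R}^\infty$ and a real number $\mu>0$ such that: (i) $W\rightarrow(X)_r$ for every integer $r\ge1$; (ii) every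 finite $W'\subseteq W$ contains a subset $Z\subseteq W'$ with $|Z|\ge\mu|W'|$ such that $Z$ is $X$-free. *)

theory Defs
  imports "HOL-Analysis.Analysis" "HOL-Library.Countable_Set"
begin

section \<open>The space of finitely supported real sequences\<close>

text \<open>
  A fresh type is introduced because the metric instance that
  \<open>HOL-Analysis.Finite_Function_Topology\<close> puts on finitely supported functions is the l1 metric,
  whereas the Euclidean (l2) metric is needed here.
\<close>

typedef rinf = "{f :: nat \<Rightarrow> real. finite {i. f i \<noteq> 0}}"
  morphisms coord Rinf
  by (rule exI[of _ "\<lambda>_. 0"]) simp

setup_lifting type_definition_rinf

lemma finite_coord_support: "finite {i. coord x i \<noteq> 0}"
  using coord[of x] by simp

lemma rinf_eqI: "(\<And>i. coord x i = coord y i) \<Longrightarrow> x = y"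
  by (simp add: coord_inject[symmetric] fun_eq_iff)

instantiation rinf :: real_vector
begin

lift_definition zero_rinf :: rinf is "\<lambda>_. 0" by simp

lift_definition plus_rinf :: "rinf \<Rightarrow> rinf \<Rightarrow> rinf" is "\<lambda>f g i. f i + g i"
proof -
  fix f g :: "nat \<Rightarrow> real"
  assume "finite {i. f i \<noteq> 0}" "finite {i. g i \<noteq> 0}"
  then have "finite ({i. f i \<noteq> 0} \<union> {i. g i \<noteq> 0})" by simp
  then show "finite {i. f i + g i \<noteq> 0}" by (rule rev_finite_subset) auto
qed

lift_definition minus_rinf :: "rinf \<Rightarrow> rinf \<Rightarrow> rinf" is "\<lambda>f g i. f i - g i"
proof -
  fix f g :: "nat \<Rightarrow> real"
  assume "finite {i. f i \<noteq> 0}" "finite {i. g i \<noteq> 0}"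
  then have "finite ({i. f i \<noteq> 0} \<union> {i. g i \<noteq> 0})" by simp
  then show "finite {i. f i - g i \<noteq> 0}" by (rule rev_finite_subset) auto
qed

lift_definition uminus_rinf :: "rinf \<Rightarrow> rinf" is "\<lambda>f i. - f i" by simp

lift_definition scaleR_rinf :: "real \<Rightarrow> rinf \<Rightarrow> rinf" is "\<lambda>c f i. c * f i"
  by (rule finite_subset) auto

instance
  by standard (transfer; simp add: fun_eq_iff algebra_simps)+

end

lemma coord_zero [simp]: "coord 0 i = 0"
  and coord_plus [simp]: "coord (x + y) i = coord x i + coord y i"
  and coord_minus [simp]: "coord (x - y) i = coord x i - coord y i"
  and coord_uminus [simp]: "coord (- x) i = - coord x i"
  and coord_scaleR [simp]: "coord (c *\<^sub>R x) i = c * coord x i"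
  by (transfer; simp)+

instantiation rinf :: real_inner
begin

definition inner_rinf :: "rinf \<Rightarrow> rinf \<Rightarrow> real" where
  "inner_rinf x y = (\<Sum>i | coord x i * coord y i \<noteq> 0. coord x i * coord y i)"

definition norm_rinf :: "rinf \<Rightarrow> real" where
  "norm_rinf x = sqrt (inner x x)"

definition dist_rinf :: "rinf \<Rightarrow> rinf \<Rightarrow> real" where
  "dist_rinf x y = norm (x - y)"

definition sgn_rinf :: "rinf \<Rightarrow> rinf" where
  "sgn_rinf x = x /\<^sub>R norm x"

definition uniformity_rinf :: "(rinf \<times> rinf) filter" where
  "uniformity_rinf = (INF e\<in>{0<..}. principal {(x, y). dist x y < e})"

definition open_rinf :: "rinf set \<Rightarrow> bool" where
  "open_rinf U \<longleftrightarrow> (\<forall>x\<in>U. \<forall>\<^sub>F (x', y) in uniformity. x' = x \<longrightarrow> y \<in> U)"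

lemma inner_rinf_eq_sum:
  assumes "finite S" "{i. coord x i \<noteq> 0} \<subseteq> S \<or> {i. coord y i \<noteq> 0} \<subseteq> S"
  shows "inner x y = (\<Sum>i\<in>S. coord x i * coord y i)"
  unfolding inner_rinf_def using assms by (intro sum.mono_neutral_left) auto

instance
proof
  fix x y z :: rinf and r :: real
  let ?S = "{i. coord x i \<noteq> 0} \<union> {i. coord y i \<noteq> 0}"
  have S: "finite ?S" by (simp add: finite_coord_support)
  show "dist x y = norm (x - y)" by (rule dist_rinf_def)
  show "sgn x = x /\<^sub>R norm x" by (rule sgn_rinf_def)
  show "(uniformity :: (rinf \<times> rinf) filter) = (INF e\<in>{0<..}. principal {(x, y). dist x y < e})"
    by (rule uniformity_rinf_def)
  show "open U = (\<forall>x\<in>U. \<forall>\<^sub>F (x', y) in uniformity. x' = x \<longrightarrow> y \<in> U)" for U :: "rinf set"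
    by (rule open_rinf_def)
  show "inner x y = inner y x" by (simp add: inner_rinf_def mult.commute)
  show "inner (x + y) z = inner x z + inner y z"
  proof -
    have "inner (x + y) z = (\<Sum>i\<in>?S. coord (x + y) i * coord z i)"
      by (rule inner_rinf_eq_sum[OF S]) auto
    moreover have "inner x z = (\<Sum>i\<in>?S. coord x i * coord z i)"
      by (rule inner_rinf_eq_sum[OF S]) auto
    moreover have "inner y z = (\<Sum>i\<in>?S. coord y i * coord z i)"
      by (rule inner_rinf_eq_sum[OF S]) auto
    ultimately show ?thesis by (simp add: distrib_right sum.distrib)
  qed
  show "inner (r *\<^sub>R x) y = r * inner x y"
  proof -
    have "inner (r *\<^sub>R x) y = (\<Sum>i\<in>?S. coord (r *\<^sub>R x) i * coord y i)"
      by (rule inner_rinf_eq_sum[OF S]) auto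
    moreover have "inner x y = (\<Sum>i\<in>?S. coord x i * coord y i)"
      by (rule inner_rinf_eq_sum[OF S]) auto
    ultimately show ?thesis by (simp add: sum_distrib_left mult.assoc)
  qed
  have sq: "inner x x = (\<Sum>i | coord x i \<noteq> 0. (coord x i)\<^sup>2)"
    by (subst inner_rinf_eq_sum[OF finite_coord_support[of x]]) (auto simp: power2_eq_square)
  show "0 \<le> inner x x" unfolding sq by (intro sum_nonneg) simp
  show "inner x x = 0 \<longleftrightarrow> x = 0"
    unfolding sq
    by (subst sum_nonneg_eq_0_iff) (auto simp: finite_coord_support intro!: rinf_eqI)
  show "norm x = sqrt (inner x x)" by (rule norm_rinf_def)
qed

end

lemma dist_rinf_eq_sum:
  assumes "finite S" "{i. coord x i \<noteq> coord y i} \<subseteq> S"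
  shows "dist x y = sqrt (\<Sum>i\<in>S. (coord x i - coord y i)\<^sup>2)"
proof -
  have "inner (x - y) (x - y) = (\<Sum>i\<in>S. coord (x - y) i * coord (x - y) i)"
    using assms by (intro inner_rinf_eq_sum) auto
  then show ?thesis
    by (simp add: dist_norm norm_rinf_def power2_eq_square)
qed


section \<open>Configurations\<close>

text \<open>
  A configuration is a set of points of type \<^typ>\<open>rinf\<close>.  Congruence and containment are stated
  between arbitrary metric spaces, so that they also apply to a product of two configurations,
  a subset of \<^typ>\<open>rinf \<times> rinf\<close> with the product metric of the library.  That
  this product space embeds isometrically into \<^typ>\<open>rinf\<close> is shown in \<open>rinf_prod_isometric_embedding\<close>
  below.
\<close>

definition is_copy :: "'a::metric_space set \<Rightarrow> 'b::metric_space set \<Rightarrow> bool" where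
  "is_copy B' B \<longleftrightarrow>
     (\<exists>f. bij_betw f B B' \<and> (\<forall>x\<in>B. \<forall>y\<in>B. dist (f x) (f y) = dist x y))"

definition contains_copy :: "'a::metric_space set \<Rightarrow> 'b::metric_space set \<Rightarrow> bool" where
  "contains_copy A B \<longleftrightarrow> (\<exists>S\<subseteq>A. is_copy S B)"

definition config_free :: "'b::metric_space set \<Rightarrow> 'a::metric_space set \<Rightarrow> bool" where
  "config_free X A \<longleftrightarrow> \<not> contains_copy A X"

definition arrows :: "'a::metric_space set \<Rightarrow> 'b::metric_space set \<Rightarrow> nat \<Rightarrow> bool" where
  "arrows A B r \<longleftrightarrow>
     (\<forall>c :: 'a \<Rightarrow> nat. c ` A \<subseteq> {..<r} \<longrightarrow>
        (\<exists>S\<subseteq>A. is_copy S B \<and> (\<exists>k<r. \<forall>x\<in>S. c x = k)))"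

definition is_brick :: "nat \<Rightarrow> rinf set \<Rightarrow> bool" where
  "is_brick d B \<longleftrightarrow>
     (\<exists>a :: nat \<Rightarrow> real. (\<forall>i<d. 0 < a i) \<and>
        is_copy B {x :: rinf. (\<forall>i<d. coord x i = 0 \<or> coord x i = a i) \<and>
                              (\<forall>i\<ge>d. coord x i = 0)})"

definition robust :: "rinf set \<Rightarrow> bool" where
  "robust Y \<longleftrightarrow> countable Y \<and>
     (\<forall>C :: rinf set. finite C \<and> contains_copy Y C \<longrightarrow> (\<forall>r\<ge>1. arrows Y C r))"

definition P_Ramsey :: "rinf set \<Rightarrow> bool" where
  "P_Ramsey X \<longleftrightarrow> finite X \<and>
     (\<exists>(W :: rinf set) (\<mu> :: real). 0 < \<mu> \<and>
        (\<forall>r\<ge>1. arrows W X r) \<and>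
        (\<forall>W'\<subseteq>W. finite W' \<longrightarrow>
           (\<exists>Z\<subseteq>W'. real (card Z) \<ge> \<mu> * real (card W') \<and> config_free X Z)))"

lemma rinf_prod_isometric_embedding:
  "\<exists>e :: rinf \<times> rinf \<Rightarrow> rinf. \<forall>p q. dist (e p) (e q) = dist p q"
proof -
  define g :: "rinf \<times> rinf \<Rightarrow> nat \<Rightarrow> real" where
    "g = (\<lambda>p i. if even i then coord (fst p) (i div 2) else coord (snd p) (i div 2))"
  have fin: "finite {i. g p i \<noteq> 0}" for p
  proof (rule finite_subset)
    show "{i. g p i \<noteq> 0} \<subseteq> (\<lambda>j. 2 * j) ` {j. coord (fst p) j \<noteq> 0}
            \<union> (\<lambda>j. 2 * j + 1) ` {j. coord (snd p) j \<noteq> 0}" (is "_ \<subseteq> ?A")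
    proof
      fix i assume i: "i \<in> {i. g p i \<noteq> 0}"
      show "i \<in> ?A"
      proof (cases "even i")
        case True
        then obtain j where "i = 2 * j" by (elim evenE)
        then show ?thesis using i by (auto simp: g_def)
      next
        case False
        then obtain j where "i = 2 * j + 1" by (elim oddE)
        then show ?thesis using i by (auto simp: g_def)
      qed
    qed
    show "finite ((\<lambda>j. 2 * j) ` {j. coord (fst p) j \<noteq> 0}
            \<union> (\<lambda>j. 2 * j + 1) ` {j. coord (snd p) j \<noteq> 0})"
      by (simp add: finite_coord_support)
  qed
  define e where "e = (\<lambda>p. Rinf (g p))"
  have ce: "coord (e p) = g p" for p
    unfolding e_def using fin by (simp add: Rinf_inverse)
  have "dist (e p) (e q) = dist p q" for p q
  proof -
    define T where "T = {i. coord (fst p) i \<noteq> 0} \<union> {i. coord (fst q) i \<noteq> 0} \<union>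
      {i. coord (snd p) i \<noteq> 0} \<union> {i. coord (snd q) i \<noteq> 0}"
    have T: "finite T" by (simp add: T_def finite_coord_support)
    let ?E = "(\<lambda>j. 2 * j) ` T" and ?O = "(\<lambda>j. 2 * j + 1) ` T"
    have "{i. g p i \<noteq> g q i} \<subseteq> ?E \<union> ?O"
    proof
      fix i assume i: "i \<in> {i. g p i \<noteq> g q i}"
      show "i \<in> ?E \<union> ?O"
      proof (cases "even i")
        case True
        then obtain j where "i = 2 * j" by (elim evenE)
        then show ?thesis using i by (auto simp: g_def T_def)
      next
        case False
        then obtain j where "i = 2 * j + 1" by (elim oddE)
        then show ?thesis using i by (auto simp: g_def T_def)
      qed
    qed
    then have "dist (e p) (e q) = sqrt (\<Sum>i\<in>?E \<union> ?O. (g p i - g q i)\<^sup>2)"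
      using T by (subst dist_rinf_eq_sum[of "?E \<union> ?O"]) (auto simp: ce)
    also have "(\<Sum>i\<in>?E \<union> ?O. (g p i - g q i)\<^sup>2)
        = (\<Sum>i\<in>?E. (g p i - g q i)\<^sup>2) + (\<Sum>i\<in>?O. (g p i - g q i)\<^sup>2)"
    proof (rule sum.union_disjoint)
      show "?E \<inter> ?O = {}" by (auto; presburger)
    qed (use T in auto)
    also have "(\<Sum>i\<in>?E. (g p i - g q i)\<^sup>2) = (\<Sum>j\<in>T. (coord (fst p) j - coord (fst q) j)\<^sup>2)"
      by (subst sum.reindex) (auto simp: inj_on_def g_def)
    also have "(\<Sum>i\<in>?O. (g p i - g q i)\<^sup>2) = (\<Sum>j\<in>T. (coord (snd p) j - coord (snd q) j)\<^sup>2)"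
      by (subst sum.reindex) (auto simp: inj_on_def g_def)
    also have "(\<Sum>j\<in>T. (coord (fst p) j - coord (fst q) j)\<^sup>2) = (dist (fst p) (fst q))\<^sup>2"
      using T by (subst dist_rinf_eq_sum[of T]) (auto simp: T_def sum_nonneg)
    also have "(\<Sum>j\<in>T. (coord (snd p) j - coord (snd q) j)\<^sup>2) = (dist (snd p) (snd q))\<^sup>2"
      using T by (subst dist_rinf_eq_sum[of T]) (auto simp: T_def sum_nonneg)
    finally show ?thesis by (simp add: dist_prod_def)
  qed
  then show ?thesis by blast
qed

end

theory Submission
  imports Defs "HOL-Library.Ramsey"
begin

text \<open>
  The vectors \<open>\<alpha> e\<^sub>i + \<beta> e\<^sub>j\<close> with \<open>i < j\<close> form a configuration \<open>G\<close> carrying the shift graph. By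
  Ramsey's theorem \<open>G \<times> Y\<close> is robust whenever \<open>Y\<close> is, and the parameters can be chosen so that two
  consecutive pairs are at distance \<open>a\<^sub>d\<close>; hence one side of the brick can be absorbed into the
  robust factor, which gives an induction on \<open>d\<close>. At the step where \<open>G \<times> Y\<close> first contains \<open>F\<close>, it
  witnesses that \<open>F\<close> is P-Ramsey: for a random set \<open>R\<close> of indices, a quarter of any finite subset
  has \<open>i \<in> R\<close>, \<open>j \<notin> R\<close>, and there \<open>G\<close> only realises the squared distances \<open>2\<alpha>\<^sup>2\<close>, \<open>2\<beta>\<^sup>2\<close>,
  \<open>2\<alpha>\<^sup>2 + 2\<beta>\<^sup>2\<close>. As \<open>Y\<close> is countable, generic \<open>\<alpha>\<close>, \<open>\<beta>\<close> avoid all squared distances that a copy of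
  \<open>F\<close> could use between distinct fibres, so such a copy would lie in a single fibre, a copy of \<open>Y\<close>.
\<close>

section \<open>Isometric maps between configurations\<close>

text \<open>Copies are handled through their witnessing maps, which compose; injectivity is
  automatic, since distinct points have positive distance.\<close>

definition isometric_into :: "('b::metric_space \<Rightarrow> 'a::metric_space) \<Rightarrow> 'b set \<Rightarrow> 'a set \<Rightarrow> bool" where
  "isometric_into f B A \<longleftrightarrow> f ` B \<subseteq> A \<and> (\<forall>x\<in>B. \<forall>y\<in>B. dist (f x) (f y) = dist x y)"

lemma isometric_into_mem: "isometric_into f B A \<Longrightarrow> x \<in> B \<Longrightarrow> f x \<in> A"
  by (auto simp: isometric_into_def)

lemma isometric_into_dist:
  "isometric_into f B A \<Longrightarrow> x \<in> B \<Longrightarrow> y \<in> B \<Longrightarrow> dist (f x) (f y) = dist x y"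
  by (auto simp: isometric_into_def)

lemma isometric_into_is_copy:
  assumes "isometric_into f B A"
  shows "is_copy (f ` B) B"
proof -
  have "inj_on f B"
    using assms unfolding isometric_into_def inj_on_def by (metis dist_eq_0_iff)
  then show ?thesis
    using assms unfolding is_copy_def isometric_into_def bij_betw_def by blast
qed

lemma is_copyE:
  assumes "is_copy B' B"
  obtains f where "isometric_into f B B'" "B' = f ` B"
  using assms unfolding is_copy_def isometric_into_def bij_betw_def by blast

lemma contains_copy_iff: "contains_copy A B \<longleftrightarrow> (\<exists>f. isometric_into f B A)"
proof
  assume "contains_copy A B"
  then obtain S where "S \<subseteq> A" "is_copy S B" by (auto simp: contains_copy_def)
  moreover obtain f where "isometric_into f B S" using is_copyE \<open>is_copy S B\<close> by blast
  ultimately show "\<exists>f. isometric_into f B A" by (auto simp: isometric_into_def)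
next
  assume "\<exists>f. isometric_into f B A"
  then obtain f where f: "isometric_into f B A" by blast
  then have "f ` B \<subseteq> A" by (auto simp: isometric_into_def)
  then show "contains_copy A B"
    using isometric_into_is_copy[OF f] by (auto simp: contains_copy_def)
qed

lemma arrows_iff:
  "arrows A B r \<longleftrightarrow> (\<forall>c :: 'a::metric_space \<Rightarrow> nat. c ` A \<subseteq> {..<r} \<longrightarrow>
     (\<exists>f k. k < r \<and> isometric_into f B A \<and> (\<forall>x\<in>B. c (f x) = k)))" (is "_ \<longleftrightarrow> ?R")
proof
  assume L: "arrows A B r"
  show ?R
  proof (intro allI impI)
    fix c :: "'a \<Rightarrow> nat" assume c: "c ` A \<subseteq> {..<r}"
    obtain S k where S: "S \<subseteq> A" "is_copy S B" "k < r" "\<forall>x\<in>S. c x = k"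
      using L[unfolded arrows_def, rule_format, OF c] by (elim exE conjE) auto
    obtain f where f: "isometric_into f B S" using is_copyE S(2) by blast
    have "isometric_into f B A" using f S(1) by (auto simp: isometric_into_def)
    moreover have "\<forall>x\<in>B. c (f x) = k" using isometric_into_mem[OF f] S(4) by simp
    ultimately show "\<exists>f k. k < r \<and> isometric_into f B A \<and> (\<forall>x\<in>B. c (f x) = k)"
      using S(3) by blast
  qed
next
  assume R: ?R
  show "arrows A B r" unfolding arrows_def
  proof (intro allI impI)
    fix c :: "'a \<Rightarrow> nat" assume c: "c ` A \<subseteq> {..<r}"
    obtain f k where f: "k < r" "isometric_into f B A" "\<forall>x\<in>B. c (f x) = k"
      using R[rule_format, OF c] by (elim exE conjE) auto
    then have "f ` B \<subseteq> A" "is_copy (f ` B) B"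
      using isometric_into_is_copy[OF f(2)] by (auto simp: isometric_into_def)
    then show "\<exists>S\<subseteq>A. is_copy S B \<and> (\<exists>k<r. \<forall>x\<in>S. c x = k)"
      using f(1,3) by (intro exI[of _ "f ` B"]) blast
  qed
qed

lemma isometric_into_comp:
  "isometric_into f B A \<Longrightarrow> isometric_into g A C \<Longrightarrow> isometric_into (g \<circ> f) B C"
  by (simp add: isometric_into_def image_subset_iff)

lemma isometric_into_map_prod:
  assumes "isometric_into f B A"
  shows "isometric_into (\<lambda>p. (f (fst p), snd p)) (B \<times> Y) (A \<times> Y)"
  using assms by (auto simp: isometric_into_def dist_prod_def)

lemma is_copy_sym:
  assumes "is_copy A B"
  shows "is_copy B A"
proof -
  obtain f where f: "bij_betw f B A" "\<forall>x\<in>B. \<forall>y\<in>B. dist (f x) (f y) = dist x y"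
    using assms by (auto simp: is_copy_def)
  have "\<forall>x\<in>A. \<forall>y\<in>A. dist (inv_into B f x) (inv_into B f y) = dist x y"
    using f by (metis bij_betw_def f_inv_into_f inv_into_into)
  then show ?thesis
    using bij_betw_inv_into[OF f(1)] by (auto simp: is_copy_def)
qed

text \<open>One embedding is fixed so that a product is again of type \<open>rinf set\<close>: this
  is what \<open>robust\<close> speaks about and what lets the construction be iterated.\<close>

definition prod_embed :: "rinf \<times> rinf \<Rightarrow> rinf" where
  "prod_embed = (SOME e. \<forall>p q. dist (e p) (e q) = dist p q)"

lemma dist_prod_embed [simp]: "dist (prod_embed p) (prod_embed q) = dist p q"
  unfolding prod_embed_def using someI_ex[OF rinf_prod_isometric_embedding] by blast

lemma dist_prod_embed_Pair: "(dist (prod_embed (x, y)) (prod_embed (x', y')))\<^sup>2 = (dist x x')\<^sup>2 + (dist y y')\<^sup>2"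
  by (simp add: dist_prod_def)

section \<open>The shift configuration\<close>

lift_definition unit_vec :: "nat \<Rightarrow> rinf" is "\<lambda>i j. if j = i then 1 else 0"
  by simp

lemma coord_unit_vec [simp]: "coord (unit_vec i) j = (if j = i then 1 else 0)"
  by transfer simp

lemma inner_unit_vec [simp]: "inner (unit_vec i) (unit_vec j) = (if i = j then 1 else 0)"
  by (subst inner_rinf_eq_sum[of "{i}"]) auto

definition shift_vec :: "real \<Rightarrow> real \<Rightarrow> nat \<Rightarrow> nat \<Rightarrow> rinf" where
  "shift_vec \<alpha> \<beta> i j = \<alpha> *\<^sub>R unit_vec i + \<beta> *\<^sub>R unit_vec j"

text \<open>Both vectors have squared norm \<open>\<alpha>\<^sup>2 + \<beta>\<^sup>2\<close>; the
  bracket is their inner product, one term for each possible coincidence of indices.\<close>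

lemma dist_shift_vec:
  assumes "i \<noteq> j" "k \<noteq> l"
  shows "(dist (shift_vec \<alpha> \<beta> i j) (shift_vec \<alpha> \<beta> k l))\<^sup>2 =
    2 * \<alpha>\<^sup>2 + 2 * \<beta>\<^sup>2 - 2 * (\<alpha>\<^sup>2 * of_bool (i = k) + \<beta>\<^sup>2 * of_bool (j = l)
      + \<alpha> * \<beta> * of_bool (i = l) + \<alpha> * \<beta> * of_bool (j = k))"
  unfolding dist_norm power2_norm_eq_inner shift_vec_def
  using assms
  by (simp add: inner_diff_left inner_diff_right inner_add_left inner_add_right)
    (simp add: power2_eq_square algebra_simps)

text \<open>Only the coincidences among the indices enter the distance, and an injection preserves
  them. Hence moving to a homogeneous index set keeps a copy a copy.\<close>

lemma dist_shift_vec_reindex: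
  assumes "inj_on h I" "{i, j, k, l} \<subseteq> I" "i \<noteq> j" "k \<noteq> l"
  shows "dist (shift_vec \<alpha> \<beta> (h i) (h j)) (shift_vec \<alpha> \<beta> (h k) (h l))
    = dist (shift_vec \<alpha> \<beta> i j) (shift_vec \<alpha> \<beta> k l)"
proof -
  have inj: "h i = h j \<longleftrightarrow> i = j" "h k = h l \<longleftrightarrow> k = l" "h i = h k \<longleftrightarrow> i = k"
    "h j = h l \<longleftrightarrow> j = l" "h i = h l \<longleftrightarrow> i = l" "h j = h k \<longleftrightarrow> j = k"
    using assms(2) by (simp_all add: inj_on_eq_iff[OF assms(1)])
  have "(dist (shift_vec \<alpha> \<beta> (h i) (h j)) (shift_vec \<alpha> \<beta> (h k) (h l)))\<^sup>2
    = (dist (shift_vec \<alpha> \<beta> i j) (shift_vec \<alpha> \<beta> k l))\<^sup>2"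
    using assms(3,4) by (simp only: dist_shift_vec inj not_False_eq_True)
  then show ?thesis by simp
qed

text \<open>The cut excludes \<open>i = l\<close> and \<open>j = k\<close>, so no mixed term
  survives; the value is decided by which of \<open>i = k\<close>, \<open>j = l\<close> holds, and
  distinctness rules out both.\<close>

lemma dist_shift_vec_cut:
  assumes "i \<in> R" "j \<notin> R" "k \<in> R" "l \<notin> R"
    and "shift_vec \<alpha> \<beta> i j \<noteq> shift_vec \<alpha> \<beta> k l"
  shows "(dist (shift_vec \<alpha> \<beta> i j) (shift_vec \<alpha> \<beta> k l))\<^sup>2 \<in> {2 * \<alpha>\<^sup>2, 2 * \<beta>\<^sup>2, 2 * \<alpha>\<^sup>2 + 2 * \<beta>\<^sup>2}"
proof -
  have "i \<noteq> j" "k \<noteq> l" "i \<noteq> l" "j \<noteq> k" using assms by auto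
  then show ?thesis using assms(5) by (auto simp: dist_shift_vec)
qed

lemma dist_shift_vec_edge:
  "(dist (shift_vec \<alpha> \<beta> 0 1) (shift_vec \<alpha> \<beta> 1 2))\<^sup>2 = 2 * (\<alpha>\<^sup>2 + \<beta>\<^sup>2 - \<alpha> * \<beta>)"
  by (simp add: dist_shift_vec)

text \<open>The substitution \<open>\<alpha> = x - y\<close>, \<open>\<beta> = x + y\<close> turns \<open>\<alpha>\<^sup>2 + \<beta>\<^sup>2 - \<alpha> \<beta>\<close> into \<open>x\<^sup>2 + 3 y\<^sup>2\<close>; for
  \<open>0 < y < a / 5\<close> each of the three squared distances below is an injective function of \<open>y\<close>.\<close>

lemma generic_shift_parameters:
  assumes a: "0 < a" and K: "countable K"
  obtains \<alpha> \<beta> :: real where "2 * (\<alpha>\<^sup>2 + \<beta>\<^sup>2 - \<alpha> * \<beta>) = a\<^sup>2"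
    "2 * \<alpha>\<^sup>2 \<notin> K" "2 * \<beta>\<^sup>2 \<notin> K" "2 * \<alpha>\<^sup>2 + 2 * \<beta>\<^sup>2 \<notin> K"
proof -
  let ?J = "{0<..<a / 5}"
  define x where "x = (\<lambda>y. sqrt (a\<^sup>2 / 2 - 3 * y\<^sup>2))"
  have y5: "y\<^sup>2 < a\<^sup>2 / 25" if "y \<in> ?J" for y
    using that a power_strict_mono[of y "a / 5" 2] by (simp add: power_divide)
  have x2: "(x y)\<^sup>2 = a\<^sup>2 / 2 - 3 * y\<^sup>2" if "y \<in> ?J" for y
    using y5[OF that] zero_le_power2[of y] unfolding x_def by (subst real_sqrt_pow2) linarith+
  \<comment> \<open>Squared, this is y^2 < a^2 / 24, which y < a / 5 ensures. It makes \<alpha> and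
    \<beta> positive and fixes the sign of the cofactor in \<open>inj2\<close>.\<close>
  have x3: "3 * y < x y" if "y \<in> ?J" for y
    unfolding x_def
  proof (rule real_less_rsqrt)
    show "(3 * y)\<^sup>2 < a\<^sup>2 / 2 - 3 * y\<^sup>2"
      using y5[OF that] a by (simp add: power_mult_distrib) (smt (verit) zero_less_power)
  qed
  define \<alpha> where "\<alpha> = (\<lambda>y. x y - y)"
  define \<beta> where "\<beta> = (\<lambda>y. x y + y)"
  have sq: "y = z" if "y \<in> ?J" "z \<in> ?J" "y\<^sup>2 = z\<^sup>2" for y z
    using that by (auto simp: power2_eq_iff)
  \<comment> \<open>Both points lie on the curve x^2 + 3 y^2 = a^2 / 2; subtract the two equations
    and factor.\<close>
  have diff: "(x y - x z) * (x y + x z) = 3 * (z - y) * (z + y)" if "y \<in> ?J" "z \<in> ?J" for y z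
    using x2[OF that(1)] x2[OF that(2)] by (simp add: power2_eq_square algebra_simps)
  have inj1: "inj_on (\<lambda>y. 2 * (\<alpha> y)\<^sup>2) ?J"
  proof (rule inj_onI)
    fix y z assume yz: "y \<in> ?J" "z \<in> ?J" and "2 * (\<alpha> y)\<^sup>2 = 2 * (\<alpha> z)\<^sup>2"
    moreover have "\<alpha> y > 0" "\<alpha> z > 0" using x3[of y] x3[of z] yz by (auto simp: \<alpha>_def)
    ultimately have "\<alpha> y = \<alpha> z" by (auto simp: power2_eq_iff)
    then have e: "x y - x z = y - z" by (simp add: \<alpha>_def)
    have "(y - z) * (x y + x z + 3 * (z + y)) = 0"
      using diff[OF yz] unfolding e by (simp add: algebra_simps)
    moreover have "x y + x z + 3 * (z + y) > 0" using x3[of y] x3[of z] yz by auto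
    ultimately show "y = z" by auto
  qed
  have inj2: "inj_on (\<lambda>y. 2 * (\<beta> y)\<^sup>2) ?J"
  proof (rule inj_onI)
    fix y z assume yz: "y \<in> ?J" "z \<in> ?J" and "2 * (\<beta> y)\<^sup>2 = 2 * (\<beta> z)\<^sup>2"
    moreover have "\<beta> y > 0" "\<beta> z > 0" using x3[of y] x3[of z] yz by (auto simp: \<beta>_def)
    ultimately have "\<beta> y = \<beta> z" by (auto simp: power2_eq_iff)
    then have e: "x y - x z = z - y" by (simp add: \<beta>_def)
    have "(z - y) * (x y + x z - 3 * (z + y)) = 0"
      using diff[OF yz] unfolding e by (simp add: algebra_simps)
    moreover have "x y + x z - 3 * (z + y) > 0" using x3[of y] x3[of z] yz by auto
    ultimately show "y = z" by auto
  qed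
  have sum: "2 * (\<alpha> y)\<^sup>2 + 2 * (\<beta> y)\<^sup>2 = 2 * a\<^sup>2 - 8 * y\<^sup>2" if "y \<in> ?J" for y
    using x2[OF that] by (simp add: \<alpha>_def \<beta>_def power2_eq_square algebra_simps)
  have inj3: "inj_on (\<lambda>y. 2 * (\<alpha> y)\<^sup>2 + 2 * (\<beta> y)\<^sup>2) ?J"
    by (rule inj_onI) (simp add: sum sq)
  \<comment> \<open>Preimages of a countable set under maps injective on the interval are countable,
    so some parameter avoids all three.\<close>
  have "countable (?J \<inter> (\<lambda>y. 2 * (\<alpha> y)\<^sup>2) -` K \<union> ?J \<inter> (\<lambda>y. 2 * (\<beta> y)\<^sup>2) -` K
      \<union> ?J \<inter> (\<lambda>y. 2 * (\<alpha> y)\<^sup>2 + 2 * (\<beta> y)\<^sup>2) -` K)" (is "countable ?E")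
    using inj1 inj2 inj3 K by (intro countable_Un countable_image_inj_Int_vimage)
  moreover have "uncountable ?J"
    using a by (simp add: uncountable_open_interval)
  ultimately obtain y where y: "y \<in> ?J" "y \<notin> ?E"
    by (meson countable_subset subsetI)
  have "2 * ((\<alpha> y)\<^sup>2 + (\<beta> y)\<^sup>2 - \<alpha> y * \<beta> y) = a\<^sup>2"
    using x2[OF y(1)] by (simp add: \<alpha>_def \<beta>_def power2_eq_square algebra_simps)
  then show thesis using y by (intro that[of "\<alpha> y" "\<beta> y"]) auto
qed

definition shift_prod :: "real \<Rightarrow> real \<Rightarrow> rinf set \<Rightarrow> rinf set" where
  "shift_prod \<alpha> \<beta> Y = {prod_embed (shift_vec \<alpha> \<beta> i j, y) | i j y. i < j \<and> y \<in> Y}"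

lemma countable_shift_prod:
  assumes "countable Y"
  shows "countable (shift_prod \<alpha> \<beta> Y)"
proof -
  have "shift_prod \<alpha> \<beta> Y \<subseteq> (\<lambda>(i, j, y). prod_embed (shift_vec \<alpha> \<beta> i j, y)) ` (UNIV \<times> UNIV \<times> Y)"
    unfolding shift_prod_def by (force simp: image_iff)
  moreover have "countable ((\<lambda>(i, j, y). prod_embed (shift_vec \<alpha> \<beta> i j, y)) ` (UNIV \<times> UNIV \<times> Y))"
    using assms by simp
  ultimately show ?thesis by (rule countable_subset)
qed

section \<open>Robustness\<close>

text \<open>The homogeneous set is enumerated increasingly, so pairs keep their orientation.
  \<open>N\<close> is chosen before \<open>c\<close>, since finitely many index pairs must be fixed
  before a fibre is selected.\<close>

lemma ramsey_pairs:
  fixes n r :: nat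
  obtains N :: nat where "\<And>c :: nat \<Rightarrow> nat \<Rightarrow> nat. (\<And>i j. i < j \<Longrightarrow> j < N \<Longrightarrow> c i j < r) \<Longrightarrow>
    \<exists>h k. k < r \<and> strict_mono_on {..<n} h \<and> h ` {..<n} \<subseteq> {..<N} \<and>
      (\<forall>i j. i < j \<longrightarrow> j < n \<longrightarrow> c (h i) (h j) = k)"
proof -
  obtain N :: nat where N: "partn_lst {..<N} (replicate r n) 2"
    using ramsey_full by blast
  show thesis
  proof (rule that[of N])
    fix c :: "nat \<Rightarrow> nat \<Rightarrow> nat" assume c: "\<And>i j. i < j \<Longrightarrow> j < N \<Longrightarrow> c i j < r"
    \<comment> \<open>Ramsey's theorem colours unordered pairs; \<open>Min\<close> and
      \<open>Max\<close> restore the orientation.\<close>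
    define f where "f = (\<lambda>E. c (Min E) (Max E))"
    have f: "f {i, j} = c i j" if "i < j" for i j
      using that by (simp add: f_def)
    have "f \<in> nsets {..<N} 2 \<rightarrow> {..<length (replicate r n)}"
    proof
      fix E assume "E \<in> nsets {..<N} 2"
      then obtain x y where "x < N" "y < N" "E = {x, y}" "x \<noteq> y"
        by (auto simp: nsets_2_eq)
      then have "\<exists>x y. E = {x, y} \<and> x < y \<and> y < N"
        by (metis insert_commute linorder_neqE_nat)
      then show "f E \<in> {..<length (replicate r n)}" using c f by auto
    qed
    then obtain k H where k: "k < r" and H: "H \<in> nsets {..<N} n" and mono: "f ` nsets H 2 \<subseteq> {k}"
      using N unfolding partn_lst_def monochromatic_def by fastforce
    have "finite H" "card H = n" "H \<subseteq> {..<N}" using H by (auto simp: nsets_def)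
    then obtain h :: "nat \<Rightarrow> nat" where h: "strict_mono_on {..<n} h" "\<forall>i<n. h i \<in> H"
      using finite_enumerate[of H] by auto
    have "c (h i) (h j) = k" if "i < j" "j < n" for i j
    proof -
      have "h i < h j" using h(1) that by (auto simp: strict_mono_on_def)
      moreover have "{h i, h j} \<in> nsets H 2" using h(2) that calculation by auto
      ultimately show ?thesis using mono f by (metis image_subset_iff singletonD)
    qed
    then show "\<exists>h k. k < r \<and> strict_mono_on {..<n} h \<and> h ` {..<n} \<subseteq> {..<N} \<and>
      (\<forall>i j. i < j \<longrightarrow> j < n \<longrightarrow> c (h i) (h j) = k)"
      using k h \<open>H \<subseteq> {..<N}\<close> by (intro exI[of _ h] exI[of _ k]) auto
  qed
qed

text \<open>Numbering \<open>V\<close> reduces this to numerical colours. The form is needed because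
  the colours used below are functions.\<close>

lemma robust_finite_colouring:
  assumes "robust Y" "finite C" "C \<subseteq> Y" "C \<noteq> {}" "finite V" "v ` Y \<subseteq> V"
  obtains h where "isometric_into h C Y" "\<And>x y. x \<in> C \<Longrightarrow> y \<in> C \<Longrightarrow> v (h x) = v (h y)"
proof -
  obtain t where t: "bij_betw t V {0..<card V}"
    using ex_bij_betw_finite_nat[OF assms(5)] by blast
  \<comment> \<open>A point of \<open>C\<close> lies in \<open>Y\<close> and so has a colour;
    \<open>robust\<close> asks for at least one colour.\<close>
  have "card V \<ge> 1"
    using assms by (auto simp: Suc_le_eq card_gt_0_iff)
  moreover have "contains_copy Y C"
    unfolding contains_copy_iff using assms(3) by (intro exI[of _ id]) (auto simp: isometric_into_def)
  ultimately have "arrows Y C (card V)"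
    using assms(1,2) by (simp add: robust_def)
  moreover have "(t \<circ> v) ` Y \<subseteq> {..<card V}"
    using t assms(6) by (fastforce simp: bij_betw_def)
  ultimately obtain h k where h: "isometric_into h C Y" "\<forall>x\<in>C. (t \<circ> v) (h x) = k"
    unfolding arrows_iff by blast
  have "v (h x) = v (h y)" if "x \<in> C" "y \<in> C" for x y
  proof -
    have "v (h x) \<in> V" "v (h y) \<in> V" using that h(1) assms(6) by (auto simp: isometric_into_def)
    moreover have "t (v (h x)) = t (v (h y))" using h(2) that by simp
    ultimately show ?thesis using t by (auto simp: bij_betw_def inj_on_def)
  qed
  then show thesis using h that by blast
qed

text \<open>Colour \<open>y \<in> Y\<close> by the colours of the finitely many points above it; on a copy in \<open>Y\<close> that is
  monochromatic for this colouring, the original colour only depends on the index pair, and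
  Ramsey's theorem for pairs applies.\<close>

lemma robust_shift_prod:
  assumes Y: "robust Y"
  shows "robust (shift_prod \<alpha> \<beta> Y)"
  unfolding robust_def
proof (intro conjI allI impI)
  show "countable (shift_prod \<alpha> \<beta> Y)"
    using Y by (simp add: robust_def countable_shift_prod)
next
  fix C :: "rinf set" and r :: nat
  assume C: "finite C \<and> contains_copy (shift_prod \<alpha> \<beta> Y) C" and r: "1 \<le> r"
  obtain f where f: "isometric_into f C (shift_prod \<alpha> \<beta> Y)"
    using C by (auto simp: contains_copy_iff)
  have "\<forall>x\<in>C. \<exists>i j y. f x = prod_embed (shift_vec \<alpha> \<beta> i j, y) \<and> i < j \<and> y \<in> Y"
    using isometric_into_mem[OF f] by (auto simp: shift_prod_def)
  then obtain I J u where fx: "\<And>x. x \<in> C \<Longrightarrow>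
      f x = prod_embed (shift_vec \<alpha> \<beta> (I x) (J x), u x) \<and> I x < J x \<and> u x \<in> Y"
    by metis
  \<comment> \<open>A strict bound for all indices occurring in the copy, as
    \<open>I x < J x\<close>.\<close>
  define n where "n = Suc (Max (J ` C))"
  have Jn: "J x < n" if "x \<in> C" for x
    using C that by (simp add: n_def less_Suc_eq_le)
  obtain N :: nat where N: "\<And>c :: nat \<Rightarrow> nat \<Rightarrow> nat. (\<And>i j. i < j \<Longrightarrow> j < N \<Longrightarrow> c i j < r) \<Longrightarrow>
    \<exists>h k. k < r \<and> strict_mono_on {..<n} h \<and> h ` {..<n} \<subseteq> {..<N} \<and>
      (\<forall>i j. i < j \<longrightarrow> j < n \<longrightarrow> c (h i) (h j) = k)"
    by (rule ramsey_pairs[where n = n and r = r]) blast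
  show "arrows (shift_prod \<alpha> \<beta> Y) C r"
    unfolding arrows_iff
  proof (intro allI impI)
    fix c :: "rinf \<Rightarrow> nat" assume c: "c ` shift_prod \<alpha> \<beta> Y \<subseteq> {..<r}"
    show "\<exists>f k. k < r \<and> isometric_into f C (shift_prod \<alpha> \<beta> Y) \<and> (\<forall>x\<in>C. c (f x) = k)"
    proof (cases "C = {}")
      case True
      then show ?thesis using r by (intro exI[of _ id] exI[of _ 0]) (auto simp: isometric_into_def)
    next
      case False
      then obtain x0 where x0: "x0 \<in> C" by blast
      \<comment> \<open>Only index pairs below \<open>N\<close> are recorded, and
        \<open>restrict\<close> fixes the value elsewhere; so the fibres show only finitely many
        colour patterns.\<close>
      define P where "P = {(i, j). i < j \<and> j < N}"
      define v where "v = (\<lambda>y. restrict (\<lambda>(i, j). c (prod_embed (shift_vec \<alpha> \<beta> i j, y))) P)"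
      have cr: "c (prod_embed (shift_vec \<alpha> \<beta> i j, y)) < r" if "i < j" "y \<in> Y" for i j y
        using c that by (fastforce simp: shift_prod_def)
      have "finite P"
        by (rule finite_subset[of _ "{..<N} \<times> {..<N}"]) (auto simp: P_def)
      then have "finite (P \<rightarrow>\<^sub>E {..<r})" by (simp add: finite_PiE)
      moreover have "v ` Y \<subseteq> P \<rightarrow>\<^sub>E {..<r}"
      proof (rule image_subsetI)
        fix y assume "y \<in> Y"
        then show "v y \<in> P \<rightarrow>\<^sub>E {..<r}"
          unfolding v_def by (intro restrict_PiE_iff[THEN iffD2]) (auto simp: P_def cr)
      qed
      moreover have "finite (u ` C)" "u ` C \<subseteq> Y" "u ` C \<noteq> {}"
        using C fx False by auto
      ultimately obtain h where h: "isometric_into h (u ` C) Y"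
        "\<And>x y. x \<in> u ` C \<Longrightarrow> y \<in> u ` C \<Longrightarrow> v (h x) = v (h y)"
        using robust_finite_colouring[OF Y, of "u ` C" "P \<rightarrow>\<^sub>E {..<r}" v] by blast
      have hY: "h (u x) \<in> Y" if "x \<in> C" for x
        using h(1) that by (auto simp: isometric_into_def)
      \<comment> \<open>Ramsey is applied in the single fibre over \<open>h (u x0)\<close>; all
        fibres over the copy carry the same pattern.\<close>
      obtain g k where k: "k < r" and g: "strict_mono_on {..<n} g" "g ` {..<n} \<subseteq> {..<N}"
        and mono: "\<And>i j. i < j \<Longrightarrow> j < n \<Longrightarrow>
          c (prod_embed (shift_vec \<alpha> \<beta> (g i) (g j), h (u x0))) = k"
        using N[of "\<lambda>i j. c (prod_embed (shift_vec \<alpha> \<beta> i j, h (u x0)))"] cr hY[OF x0] by blast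
      \<comment> \<open>The two factors move independently: indices by \<open>g\<close>, points of
        \<open>Y\<close> by \<open>h\<close>.\<close>
      define f' where "f' = (\<lambda>x. prod_embed (shift_vec \<alpha> \<beta> (g (I x)) (g (J x)), h (u x)))"
      have gIJ: "g (I x) < g (J x)" "g (J x) < N" if "x \<in> C" for x
      proof -
        have "I x < J x" "J x < n" using fx Jn that by auto
        then show "g (I x) < g (J x)" "g (J x) < N"
          using g by (auto simp: strict_mono_on_def)
      qed
      have "isometric_into f' C (shift_prod \<alpha> \<beta> Y)"
        unfolding isometric_into_def
      proof (intro conjI ballI)
        show "f' ` C \<subseteq> shift_prod \<alpha> \<beta> Y"
          using gIJ hY by (fastforce simp: f'_def shift_prod_def)
        fix x y assume xy: "x \<in> C" "y \<in> C"
        have "dist (shift_vec \<alpha> \<beta> (g (I x)) (g (J x))) (shift_vec \<alpha> \<beta> (g (I y)) (g (J y)))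
          = dist (shift_vec \<alpha> \<beta> (I x) (J x)) (shift_vec \<alpha> \<beta> (I y) (J y))"
        proof (rule dist_shift_vec_reindex[where I = "{..<n}"])
          show "inj_on g {..<n}" using g(1) by (rule strict_mono_on_imp_inj_on)
          show "{I x, J x, I y, J y} \<subseteq> {..<n}" "I x \<noteq> J x" "I y \<noteq> J y"
            using fx[OF xy(1)] fx[OF xy(2)] Jn[OF xy(1)] Jn[OF xy(2)] by auto
        qed
        moreover have "dist (h (u x)) (h (u y)) = dist (u x) (u y)"
          using h(1) xy by (simp add: isometric_into_def)
        ultimately have "dist (f' x) (f' y) = dist (f x) (f y)"
          using fx xy by (simp add: f'_def dist_prod_def)
        then show "dist (f' x) (f' y) = dist x y"
          using isometric_into_dist[OF f] xy by simp
      qed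
      moreover have "c (f' x) = k" if "x \<in> C" for x
      proof -
        have "v (h (u x)) = v (h (u x0))" using h(2) that x0 by blast
        then have "v (h (u x)) (g (I x), g (J x)) = v (h (u x0)) (g (I x), g (J x))" by simp
        then have "c (f' x) = c (prod_embed (shift_vec \<alpha> \<beta> (g (I x)) (g (J x)), h (u x0)))"
          using gIJ[OF that] by (simp add: v_def P_def f'_def)
        then show ?thesis using mono fx[OF that] Jn[OF that] by simp
      qed
      ultimately show ?thesis using k by blast
    qed
  qed
qed

section \<open>Density\<close>

text \<open>Inserting \<open>i\<close> into the subsets of \<open>U - {i, j}\<close> already yields
  a quarter of all subsets of \<open>U\<close>.\<close>

lemma card_cuts_ge:
  assumes "finite U" "i \<in> U" "j \<in> U" "i \<noteq> j"
  shows "4 * card {R \<in> Pow U. i \<in> R \<and> j \<notin> R} \<ge> 2 ^ card U"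
proof -
  have "insert i ` Pow (U - {i, j}) \<subseteq> {R \<in> Pow U. i \<in> R \<and> j \<notin> R}"
    using assms by auto
  then have "card (insert i ` Pow (U - {i, j})) \<le> card {R \<in> Pow U. i \<in> R \<and> j \<notin> R}"
    using assms(1) by (intro card_mono) auto
  moreover have "inj_on (insert i) (Pow (U - {i, j}))"
    by (rule inj_onI) blast
  then have "card (insert i ` Pow (U - {i, j})) = 2 ^ card (U - {i, j})"
    using assms(1) by (simp add: card_image card_Pow)
  moreover have "card U = card (U - {i, j}) + 2"
  proof -
    have "card {i, j} \<le> card U" using assms by (intro card_mono) auto
    then show ?thesis using assms by (simp add: card_Diff_subset)
  qed
  ultimately show ?thesis by (simp add: power_add)
qed

text \<open>Averaging over all sets \<open>R\<close> of occurring indices: each \<open>w\<close> is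
  cut by at least a quarter of them, so some \<open>R\<close> cuts at least a quarter of
  \<open>W\<close>.\<close>

lemma exists_large_cut:
  fixes I J :: "'a \<Rightarrow> 'b"
  assumes W: "finite W" and IJ: "\<And>w. w \<in> W \<Longrightarrow> I w \<noteq> J w"
  obtains R where "4 * card {w \<in> W. I w \<in> R \<and> J w \<notin> R} \<ge> card W"
proof (rule ccontr)
  assume "\<not> thesis"
  then have small: "4 * card {w \<in> W. I w \<in> R \<and> J w \<notin> R} < card W" for R
    using that by (meson linorder_not_less)
  define U where "U = I ` W \<union> J ` W"
  have U: "finite U" using W by (simp add: U_def)
  have "2 ^ card U * card W = (\<Sum>w\<in>W. 2 ^ card U)" by simp
  also have "\<dots> \<le> (\<Sum>w\<in>W. 4 * card {R \<in> Pow U. I w \<in> R \<and> J w \<notin> R})"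
    using U IJ by (intro sum_mono card_cuts_ge) (auto simp: U_def)
  also have "\<dots> = 4 * (\<Sum>w\<in>W. card {R \<in> Pow U. I w \<in> R \<and> J w \<notin> R})"
    by (simp add: sum_distrib_left)
  \<comment> \<open>Double counting of the pairs \<open>(w, R)\<close> where \<open>R\<close> cuts
    \<open>w\<close>.\<close>
  also have "(\<Sum>w\<in>W. card {R \<in> Pow U. I w \<in> R \<and> J w \<notin> R})
      = (\<Sum>R\<in>Pow U. card {w \<in> W. I w \<in> R \<and> J w \<notin> R})"
    using W U by (intro sum_multicount_gen) auto
  also have "4 * \<dots> = (\<Sum>R\<in>Pow U. 4 * card {w \<in> W. I w \<in> R \<and> J w \<notin> R})"
    by (simp add: sum_distrib_left)
  also have "\<dots> < (\<Sum>R\<in>Pow U. card W)"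
    using U small by (intro sum_strict_mono) auto
  also have "\<dots> = 2 ^ card U * card W" using U by (simp add: card_Pow)
  finally show False by simp
qed

text \<open>In a copy of \<open>F\<close> inside the cut, the squared distance of two shift vectors
  lies in \<open>K\<close>, while distinct ones only realise the three values outside
  \<open>K\<close>. So the shift vectors agree and the \<open>Y\<close> components form a copy of
  \<open>F\<close>.\<close>

lemma dense_free_subset_shift_prod:
  fixes F Y :: "rinf set"
  assumes free: "\<not> contains_copy Y F"
    and K: "\<And>x x' y y'. x \<in> F \<Longrightarrow> x' \<in> F \<Longrightarrow> y \<in> Y \<Longrightarrow> y' \<in> Y \<Longrightarrow> (dist x x')\<^sup>2 - (dist y y')\<^sup>2 \<in> K"
    and gen: "2 * \<alpha>\<^sup>2 \<notin> K" "2 * \<beta>\<^sup>2 \<notin> K" "2 * \<alpha>\<^sup>2 + 2 * \<beta>\<^sup>2 \<notin> K"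
    and W: "W \<subseteq> shift_prod \<alpha> \<beta> Y" "finite W"
  obtains Z where "Z \<subseteq> W" "4 * card Z \<ge> card W" "config_free F Z"
proof -
  have "\<forall>w\<in>W. \<exists>i j y. w = prod_embed (shift_vec \<alpha> \<beta> i j, y) \<and> i < j \<and> y \<in> Y"
    using W by (auto simp: shift_prod_def)
  then obtain I J u where wx: "\<And>w. w \<in> W \<Longrightarrow>
      w = prod_embed (shift_vec \<alpha> \<beta> (I w) (J w), u w) \<and> I w < J w \<and> u w \<in> Y"
    by metis
  have "I w \<noteq> J w" if "w \<in> W" for w using wx[OF that] by simp
  then obtain R where R: "4 * card {w \<in> W. I w \<in> R \<and> J w \<notin> R} \<ge> card W"
    using exists_large_cut[OF W(2), of I J] by blast
  define Z where "Z = {w \<in> W. I w \<in> R \<and> J w \<notin> R}"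
  have "config_free F Z"
    unfolding config_free_def contains_copy_iff
  proof
    assume "\<exists>f. isometric_into f F Z"
    then obtain f where f: "isometric_into f F Z" by blast
    have fZ: "f x \<in> Z" if "x \<in> F" for x using f that by (rule isometric_into_mem)
    have uY: "u (f x) \<in> Y" if "x \<in> F" for x using fZ[OF that] wx by (auto simp: Z_def)
    have "dist (u (f x)) (u (f y)) = dist x y" if xy: "x \<in> F" "y \<in> F" for x y
    proof -
      let ?p = "shift_vec \<alpha> \<beta> (I (f x)) (J (f x))" and ?q = "shift_vec \<alpha> \<beta> (I (f y)) (J (f y))"
      have "f x = prod_embed (?p, u (f x))" "f y = prod_embed (?q, u (f y))"
        using fZ[OF xy(1)] fZ[OF xy(2)] wx by (auto simp: Z_def)
      then have "(dist (f x) (f y))\<^sup>2 = (dist ?p ?q)\<^sup>2 + (dist (u (f x)) (u (f y)))\<^sup>2"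
        by (metis dist_prod_embed_Pair)
      then have d: "(dist x y)\<^sup>2 = (dist ?p ?q)\<^sup>2 + (dist (u (f x)) (u (f y)))\<^sup>2"
        using isometric_into_dist[OF f] xy by simp
      have "?p = ?q"
      proof (rule ccontr)
        assume "?p \<noteq> ?q"
        then have "(dist ?p ?q)\<^sup>2 \<in> {2 * \<alpha>\<^sup>2, 2 * \<beta>\<^sup>2, 2 * \<alpha>\<^sup>2 + 2 * \<beta>\<^sup>2}"
          using fZ[OF xy(1)] fZ[OF xy(2)] by (intro dist_shift_vec_cut[of _ R]) (auto simp: Z_def)
        moreover have "(dist ?p ?q)\<^sup>2 \<in> K"
          using K[OF xy uY[OF xy(1)] uY[OF xy(2)]] d by simp
        ultimately show False using gen by auto
      qed
      then show ?thesis using d by simp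
    qed
    then have "isometric_into (u \<circ> f) F Y"
      using uY by (auto simp: isometric_into_def)
    then show False using free by (auto simp: contains_copy_iff)
  qed
  then show thesis using R by (intro that[of Z]) (auto simp: Z_def)
qed

section \<open>Induction on the dimension of the brick\<close>

text \<open>The sides form one infinite sequence, so \<open>a\<close> stays the same when the
  dimension drops.\<close>

definition box_vertices :: "nat \<Rightarrow> (nat \<Rightarrow> real) \<Rightarrow> rinf set" where
  "box_vertices d a = {x. (\<forall>i<d. coord x i = 0 \<or> coord x i = a i) \<and> (\<forall>i\<ge>d. coord x i = 0)}"

lemma dist_box_vertices:
  assumes "x \<in> box_vertices d a" "y \<in> box_vertices d a"
  shows "(dist x y)\<^sup>2 = (\<Sum>i<d. (coord x i - coord y i)\<^sup>2)"
proof -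
  have "{i. coord x i \<noteq> coord y i} \<subseteq> {..<d}"
  proof
    fix i assume "i \<in> {i. coord x i \<noteq> coord y i}"
    then show "i \<in> {..<d}"
      using assms by (cases "i < d") (simp_all add: box_vertices_def)
  qed
  from dist_rinf_eq_sum[OF _ this] show ?thesis
    by (simp add: sum_nonneg)
qed

text \<open>Pythagoras: the two values of the last coordinate are traded for the shift vectors of
  the pairs (0, 1) and (1, 2), which \<open>edge\<close> puts at the same distance.\<close>

lemma box_vertices_Suc_isometric:
  assumes edge: "2 * (\<alpha>\<^sup>2 + \<beta>\<^sup>2 - \<alpha> * \<beta>) = (a d)\<^sup>2"
  shows "\<exists>f. isometric_into f (box_vertices (Suc d) a \<times> Y) (box_vertices d a \<times> shift_prod \<alpha> \<beta> Y)"
proof -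
  define t where "t = (\<lambda>x. x - coord x d *\<^sub>R unit_vec d)"
  define s where "s = (\<lambda>x. if coord x d = 0 then shift_vec \<alpha> \<beta> 0 1 else shift_vec \<alpha> \<beta> 1 2)"
  define f where "f = (\<lambda>(x, y). (t x, prod_embed (s x, y)))"
  have t: "t x \<in> box_vertices d a" if "x \<in> box_vertices (Suc d) a" for x
    using that by (auto simp: box_vertices_def t_def less_Suc_eq Suc_le_eq)
  have "isometric_into f (box_vertices (Suc d) a \<times> Y) (box_vertices d a \<times> shift_prod \<alpha> \<beta> Y)"
    unfolding isometric_into_def
  proof (intro conjI ballI)
    show "f ` (box_vertices (Suc d) a \<times> Y) \<subseteq> box_vertices d a \<times> shift_prod \<alpha> \<beta> Y"
    proof (rule image_subsetI)
      fix p assume "p \<in> box_vertices (Suc d) a \<times> Y"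
      then obtain x y where p: "p = (x, y)" and "x \<in> box_vertices (Suc d) a" "y \<in> Y" by blast
      moreover have "\<exists>i j. s x = shift_vec \<alpha> \<beta> i j \<and> i < j"
        unfolding s_def by (metis one_less_numeral_iff semiring_norm(76) zero_less_one)
      ultimately have "prod_embed (s x, y) \<in> shift_prod \<alpha> \<beta> Y"
        unfolding shift_prod_def by force
      then show "f p \<in> box_vertices d a \<times> shift_prod \<alpha> \<beta> Y"
        using t \<open>x \<in> box_vertices (Suc d) a\<close> by (simp add: f_def p)
    qed
    fix p q assume pq: "p \<in> box_vertices (Suc d) a \<times> Y" "q \<in> box_vertices (Suc d) a \<times> Y"
    obtain x y where p: "p = (x, y)" by fastforce
    obtain x' y' where q: "q = (x', y')" by fastforce
    have x: "x \<in> box_vertices (Suc d) a" "x' \<in> box_vertices (Suc d) a" using pq p q by auto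
    have "(dist (s x) (s x'))\<^sup>2 = (coord x d - coord x' d)\<^sup>2"
    proof -
      have "coord x d = 0 \<or> coord x d = a d" "coord x' d = 0 \<or> coord x' d = a d"
        using x by (auto simp: box_vertices_def)
      then show ?thesis
        using edge dist_shift_vec_edge[of \<alpha> \<beta>] by (auto simp: s_def dist_commute)
    qed
    moreover have "(dist (t x) (t x'))\<^sup>2 = (\<Sum>i<d. (coord x i - coord x' i)\<^sup>2)"
      using dist_box_vertices[OF t[OF x(1)] t[OF x(2)]] by (simp add: t_def)
    ultimately have "(dist x x')\<^sup>2 = (dist (t x) (t x'))\<^sup>2 + (dist (s x) (s x'))\<^sup>2"
      using dist_box_vertices[OF x] by simp
    then show "dist (f p) (f q) = dist p q"
      by (simp add: p q f_def dist_prod_def)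
  qed
  then show ?thesis by blast
qed

text \<open>\<open>Y\<close> must vary in the induction, because each step replaces it by
  \<open>shift_prod \<alpha> \<beta> Y\<close>.\<close>

lemma P_Ramsey_box_vertices:
  fixes F Y :: "rinf set"
  assumes "\<And>i. i < d \<Longrightarrow> 0 < a i" "robust Y" "finite F"
    "contains_copy (box_vertices d a \<times> Y) F" "\<not> contains_copy Y F"
  shows "P_Ramsey F"
  using assms
proof (induction d arbitrary: Y)
  \<comment> \<open>The box is the origin alone, so the product is a single copy of
    \<open>Y\<close>, contradicting the hypothesis on \<open>F\<close>.\<close>
  case 0
  then obtain f where f: "isometric_into f F (box_vertices 0 a \<times> Y)"
    by (auto simp: contains_copy_iff)
  have fst0: "fst (f x) = 0" if "x \<in> F" for x
    using isometric_into_mem[OF f that] by (auto simp: box_vertices_def intro: rinf_eqI)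
  have "isometric_into (snd \<circ> f) F Y"
    unfolding isometric_into_def
  proof (intro conjI ballI)
    show "(snd \<circ> f) ` F \<subseteq> Y" using isometric_into_mem[OF f] by fastforce
    fix x y assume "x \<in> F" "y \<in> F"
    then show "dist ((snd \<circ> f) x) ((snd \<circ> f) y) = dist x y"
      using isometric_into_dist[OF f, of x y] fst0 by (simp add: dist_prod_def)
  qed
  then show ?case using 0 by (auto simp: contains_copy_iff)
next
  case (Suc d)
  define K where "K = (\<lambda>(x, x', y, y'). (dist x x')\<^sup>2 - (dist y y')\<^sup>2) ` (F \<times> F \<times> Y \<times> Y)"
  have K: "(dist x x')\<^sup>2 - (dist y y')\<^sup>2 \<in> K"
    if "x \<in> F" "x' \<in> F" "y \<in> Y" "y' \<in> Y" for x x' y y'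
    unfolding K_def using that by (intro image_eqI[of _ _ "(x, x', y, y')"]) simp_all
  have "countable K"
    using Suc.prems by (auto simp: K_def robust_def countable_finite)
  then obtain \<alpha> \<beta> where edge: "2 * (\<alpha>\<^sup>2 + \<beta>\<^sup>2 - \<alpha> * \<beta>) = (a d)\<^sup>2"
    and gen: "2 * \<alpha>\<^sup>2 \<notin> K" "2 * \<beta>\<^sup>2 \<notin> K" "2 * \<alpha>\<^sup>2 + 2 * \<beta>\<^sup>2 \<notin> K"
    using generic_shift_parameters[of "a d" K] Suc.prems(1) by auto
  let ?W = "shift_prod \<alpha> \<beta> Y"
  have W: "robust ?W" using Suc.prems(2) by (rule robust_shift_prod)
  show ?case
  \<comment> \<open>Either the enlarged factor contains \<open>F\<close> and witnesses the claim
    with density 1/4, or it takes the role of \<open>Y\<close> against a box of one dimension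
    less.\<close>
  proof (cases "contains_copy ?W F")
    case True
    have "\<exists>Z\<subseteq>W'. real (card Z) \<ge> 1 / 4 * real (card W') \<and> config_free F Z"
      if W': "W' \<subseteq> ?W" "finite W'" for W'
    proof -
      obtain Z where "Z \<subseteq> W'" "4 * card Z \<ge> card W'" "config_free F Z"
        using dense_free_subset_shift_prod[OF Suc.prems(5) K gen W'] by blast
      then show ?thesis by (intro exI[of _ Z]) auto
    qed
    moreover have "\<forall>r\<ge>1. arrows ?W F r"
      using W True Suc.prems(3) by (simp add: robust_def)
    ultimately show ?thesis
      unfolding P_Ramsey_def using Suc.prems(3)
      by (intro conjI exI[of _ ?W] exI[of _ "1 / 4"]) auto
  next
    case False
    obtain f where "isometric_into f F (box_vertices (Suc d) a \<times> Y)"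
      using Suc.prems(4) by (auto simp: contains_copy_iff)
    moreover obtain g where
      "isometric_into g (box_vertices (Suc d) a \<times> Y) (box_vertices d a \<times> ?W)"
      using box_vertices_Suc_isometric[where a = a and d = d, OF edge] by blast
    ultimately have "contains_copy (box_vertices d a \<times> ?W) F"
      unfolding contains_copy_iff using isometric_into_comp by blast
    then show ?thesis using Suc.IH[OF _ W Suc.prems(3) _ False] Suc.prems(1) by simp
  qed
qed

theorem theorem3p4:
  fixes d :: nat and B Y F :: "rinf set"
  assumes "d \<ge> 1"
    and "is_brick d B"
    and "robust Y"
    and "finite F"
    and "contains_copy (B \<times> Y) F"
    and "\<not> contains_copy Y F"
  shows "P_Ramsey F"
proof -
  obtain a where a: "\<forall>i<d. 0 < a i" and "is_copy B (box_vertices d a)"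
    using assms(2) unfolding is_brick_def box_vertices_def by blast
  \<comment> \<open>\<open>is_brick\<close> supplies a map from the box onto \<open>B\<close>; the
    opposite direction is needed to carry \<open>B \<times> Y\<close> into the product with the
    box.\<close>
  then obtain g where "isometric_into g B (box_vertices d a)"
    using is_copyE[OF is_copy_sym] by blast
  moreover obtain f where "isometric_into f F (B \<times> Y)"
    using assms(5) by (auto simp: contains_copy_iff)
  ultimately have "contains_copy (box_vertices d a \<times> Y) F"
    unfolding contains_copy_iff using isometric_into_map_prod isometric_into_comp by blast
  then show ?thesis
    using P_Ramsey_box_vertices[of d a Y F] a assms by blast
qed

end
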